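(* Let $G=(V,E)$ be a finite connected simple graph such that $\gcd\{\deg v: v\in V\}=1$. Then exactly one of the following two cases holds: (1) $\chi^{\mathrm{FAT}}(G)=1$ and $G$ is not bipartite; (2) $\chi^{\mathrm{FAT}}(G)=2$ and $G$ is bipartite.
   Context: For $v\in V$ and $S\subseteq V$, let $e(v,S)$ denote the number of neighbors of $v$ in $S$. A vertex $k$-coloring of $G$ is a function $c:V\to\{1,\ldots,k\}$ with coloring classes $V_i=c^{-1}(i)$. It is Fair and Tolerant (FAT) if there exists $\alpha\in[0,1]$ such that, with $\beta:=1-(k-1)\alpha$, for every vertex $v$ and every $i$ we have $e(v,V_i)=\alpha\deg v$ if $v\notin V_i$ and $e(v,V_i)=\beta\deg v$ if $v\in V_i$. The FAT chromatic number $\chi^{\mathrm{FAT}}(G)$ is the largest integer $k$ such that $G$ admits a FAT $k$-coloring.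
   Formalization: A k-coloring is required to use all k colors (every class nonempty); without this the constant coloring with α=0 would be FAT for every k, and the largest k defining the FAT chromatic number would not exist. *)

theory Defs
  imports Complex_Main "Graph_Theory.Digraph_Component"
begin

text \<open>
  As in the \<open>Graph_Theory\<close> entry, a finite simple graph is a finite, loop-free, symmetric digraph
  without multiple arcs (locale \<open>graph\<close>): an undirected edge is a pair of opposite arcs, so the
  degree of a vertex is its \<open>out_degree\<close>. The library's \<open>connected\<close> requires a nonempty vertex set.
\<close>

definition nbrs_in :: "('a, 'b) pre_digraph \<Rightarrow> 'a \<Rightarrow> 'a set \<Rightarrow> nat" where
  "nbrs_in G v S = card {u \<in> S. v \<rightarrow>\<^bsub>G\<^esub> u}"

definition color_class :: "('a, 'b) pre_digraph \<Rightarrow> ('a \<Rightarrow> nat) \<Rightarrow> nat \<Rightarrow> 'a set" where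
  "color_class G c i = {v \<in> verts G. c v = i}"

text \<open>
  All \<open>k\<close> coloring classes are required to be nonempty. Otherwise a constant coloring would be
  FAT for every \<open>k\<close> (with \<open>\<alpha> = 0\<close>) and no largest \<open>k\<close> would exist.
\<close>

definition fat_coloring :: "('a, 'b) pre_digraph \<Rightarrow> nat \<Rightarrow> ('a \<Rightarrow> nat) \<Rightarrow> bool" where
  "fat_coloring G k c \<longleftrightarrow>
     c ` verts G = {1..k} \<and>
     (\<exists>\<alpha>::real. 0 \<le> \<alpha> \<and> \<alpha> \<le> 1 \<and>
        (let \<beta> = 1 - (real k - 1) * \<alpha> in
         \<forall>v \<in> verts G. \<forall>i \<in> {1..k}.
           (v \<notin> color_class G c i \<longrightarrow>
              real (nbrs_in G v (color_class G c i)) = \<alpha> * real (out_degree G v)) \<and>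
           (v \<in> color_class G c i \<longrightarrow>
              real (nbrs_in G v (color_class G c i)) = \<beta> * real (out_degree G v))))"

definition fat_chromatic_number :: "('a, 'b) pre_digraph \<Rightarrow> nat" where
  "fat_chromatic_number G = (GREATEST k. \<exists>c. fat_coloring G k c)"

definition bipartite :: "('a, 'b) pre_digraph \<Rightarrow> bool" where
  "bipartite G \<longleftrightarrow>
     (\<exists>A B. verts G = A \<union> B \<and> A \<inter> B = {} \<and>
        (\<forall>u v. u \<rightarrow>\<^bsub>G\<^esub> v \<longrightarrow> (u \<in> A \<and> v \<in> B) \<or> (u \<in> B \<and> v \<in> A)))"

lemma fat_coloring_le_card:
  assumes "finite (verts G)" "fat_coloring G k c"
  shows "k \<le> card (verts G)"
  using assms card_image_le[of "verts G" c] by (simp add: fat_coloring_def)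

lemma (in graph) nbrs_in_verts: "nbrs_in G v (verts G) = out_degree G v"
proof -
  have "{u \<in> verts G. v \<rightarrow>\<^bsub>G\<^esub> u} = head G ` out_arcs G v"
    by (auto simp: arcs_ends_conv out_arcs_def)
  moreover have "inj_on (head G) (out_arcs G v)"
    by (auto simp: inj_on_def out_arcs_def arc_to_ends_def intro!: no_multi_arcs)
  ultimately show ?thesis
    by (simp add: nbrs_in_def out_degree_def card_image)
qed

lemma (in graph) fat_coloring_one:
  assumes "verts G \<noteq> {}"
  shows "fat_coloring G 1 (\<lambda>_. 1)"
  using assms nbrs_in_verts
  by (auto simp: fat_coloring_def color_class_def intro!: exI[of _ 0])

text \<open>The maximum defining the FAT chromatic number is attained and is an upper bound.\<close>

lemma (in graph) fat_chromatic_number: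
  assumes "verts G \<noteq> {}"
  shows "\<exists>c. fat_coloring G (fat_chromatic_number G) c"
    and "fat_coloring G k c \<Longrightarrow> k \<le> fat_chromatic_number G"
proof -
  have bound: "\<And>k. \<exists>c. fat_coloring G k c \<Longrightarrow> k \<le> card (verts G)"
    using fat_coloring_le_card finite_verts by blast
  show "\<exists>c. fat_coloring G (fat_chromatic_number G) c"
    unfolding fat_chromatic_number_def
    by (rule GreatestI_nat[where P = "\<lambda>k. \<exists>c. fat_coloring G k c"])
      (use fat_coloring_one[OF assms] bound in blast)+
  show "k \<le> fat_chromatic_number G" if "fat_coloring G k c"
    unfolding fat_chromatic_number_def
    by (rule Greatest_le_nat[where P = "\<lambda>k. \<exists>c. fat_coloring G k c"])
      (use that bound in blast)+
qed

end

theory Submission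
  imports Defs
begin

text \<open>
  If \<open>k \<ge> 2\<close>, every vertex misses some class of a FAT \<open>k\<close>-coloring, so \<open>\<alpha> * deg v\<close> is an integer
  for all \<open>v\<close>. As the degrees have gcd 1, Bezout makes \<open>\<alpha>\<close> itself an integer, that is 0 or 1. For
  \<open>\<alpha> = 0\<close> the coloring is constant along edges, contradicting connectedness. For \<open>\<alpha> = 1\<close>, a vertex
  of positive degree forces \<open>\<beta> = 2 - k\<close> to be nonnegative, so \<open>k = 2\<close> and \<open>\<beta> = 0\<close>: the coloring is
  proper. Conversely, a bipartition with at least one edge is a FAT 2-coloring with \<open>\<alpha> = 1\<close>.
\<close>

text \<open>The numbers \<open>n\<close> with \<open>x * of_nat n\<close> an integer are closed
  under integer combinations, and Bezout writes \<open>Gcd (insert n S)\<close> as such a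
  combination of \<open>n\<close> and \<open>Gcd S\<close>. The induction starts at
  \<open>Gcd {} = 0\<close>.\<close>

lemma mult_Gcd_in_Ints:
  fixes x :: "'a::comm_ring_1" and S :: "nat set"
  assumes "finite S" "\<And>n. n \<in> S \<Longrightarrow> x * of_nat n \<in> \<int>"
  shows "x * of_nat (Gcd S) \<in> \<int>"
  using assms
proof (induction S rule: finite_induct)
  case empty
  then show ?case by simp
next
  case (insert n S)
  obtain a b where ab: "a * int n + b * int (Gcd S) = gcd (int n) (int (Gcd S))"
    using bezout_int by blast
  have "of_nat (Gcd (insert n S)) = (of_int (gcd (int n) (int (Gcd S))) :: 'a)"
    by simp
  also have "\<dots> = of_int (int n * a + int (Gcd S) * b)"
    unfolding ab[symmetric] by (simp add: mult.commute)
  finally have "x * of_nat (Gcd (insert n S)) =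
      x * of_nat n * of_int a + x * of_nat (Gcd S) * of_int b"
    by (simp add: algebra_simps)
  then show ?case
    using insert by simp
qed

context graph
begin

lemma nbrs_in_eq_0_iff: "S \<subseteq> verts G \<Longrightarrow> nbrs_in G v S = 0 \<longleftrightarrow> (\<forall>u\<in>S. \<not> v \<rightarrow>\<^bsub>G\<^esub> u)"
  using finite_subset[of S "verts G"] by (auto simp: nbrs_in_def)

text \<open>Symmetry of the arcs turns connectedness into directed reachability, and
  \<open>f\<close> keeps its value along each arc of a path.\<close>

lemma connected_const:
  assumes "connected G" "\<And>u v. u \<rightarrow>\<^bsub>G\<^esub> v \<Longrightarrow> f u = f v" "u \<in> verts G" "v \<in> verts G"
  shows "f u = f v"
proof -
  have "u \<rightarrow>\<^sup>*\<^bsub>G\<^esub> v"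
    using symmetric_connected_imp_strongly_connected[OF sym_arcs assms(1)] assms(3,4) by blast
  then show ?thesis
    by (induction rule: reachable_induct) (use assms(2) in auto)
qed

text \<open>All neighbors of a vertex lie on the opposite side, so coloring by sides is FAT with
  \<alpha> = 1 and \<beta> = 0. The arc from \<open>u\<close> to \<open>w\<close> guarantees that
  both sides are nonempty.\<close>

lemma bipartite_fat_coloring:
  assumes "bipartite G" "u \<rightarrow>\<^bsub>G\<^esub> w"
  shows "\<exists>c. fat_coloring G 2 c"
proof -
  obtain A B where AB: "verts G = A \<union> B" "A \<inter> B = {}"
    and arc: "\<And>u v. u \<rightarrow>\<^bsub>G\<^esub> v \<Longrightarrow> (u \<in> A \<and> v \<in> B) \<or> (u \<in> B \<and> v \<in> A)"
    using assms(1) unfolding bipartite_def by metis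
  define c :: "'a \<Rightarrow> nat" where "c v = (if v \<in> A then 1 else 2)" for v
  have cls: "color_class G c 1 = A" "color_class G c 2 = B"
    using AB by (auto simp: color_class_def c_def)
  have two: "{1..2} = {1, 2::nat}" by auto
  have "c ` verts G = {1, 2}"
    using arc[OF assms(2)] AB by (auto simp: c_def image_iff)
  moreover have "nbrs_in G v A = (if v \<in> B then out_degree G v else 0)"
      "nbrs_in G v B = (if v \<in> A then out_degree G v else 0)" if "v \<in> verts G" for v
  proof -
    have "{u \<in> A. v \<rightarrow>\<^bsub>G\<^esub> u} = (if v \<in> B then {u \<in> verts G. v \<rightarrow>\<^bsub>G\<^esub> u} else {})"
      "{u \<in> B. v \<rightarrow>\<^bsub>G\<^esub> u} = (if v \<in> A then {u \<in> verts G. v \<rightarrow>\<^bsub>G\<^esub> u} else {})"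
      using arc AB by auto
    then show "nbrs_in G v A = (if v \<in> B then out_degree G v else 0)"
      "nbrs_in G v B = (if v \<in> A then out_degree G v else 0)"
      unfolding nbrs_in_verts[symmetric] nbrs_in_def by simp_all
  qed
  ultimately have "fat_coloring G 2 c"
    unfolding fat_coloring_def two using AB by (auto simp: Let_def cls[simplified] intro!: exI[of _ 1])
  then show ?thesis by blast
qed

lemma fat_coloring_Gcd_1:
  assumes conn: "connected G" and gcd: "Gcd (out_degree G ` verts G) = 1"
    and fat: "fat_coloring G k c" and k: "2 \<le> k"
  shows "k = 2 \<and> bipartite G"
proof -
  \<comment> \<open>The two FAT conditions are restated with the color \<open>c v\<close> in place
    of class membership; the second is taken at \<open>i = c v\<close>.\<close>
  obtain \<alpha> :: real where img: "c ` verts G = {1..k}" and \<alpha>: "0 \<le> \<alpha>" "\<alpha> \<le> 1"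
    and other: "\<And>v i. \<lbrakk>v \<in> verts G; i \<in> {1..k}; c v \<noteq> i\<rbrakk> \<Longrightarrow>
      real (nbrs_in G v (color_class G c i)) = \<alpha> * real (out_degree G v)"
    and own: "\<And>v. v \<in> verts G \<Longrightarrow>
      real (nbrs_in G v (color_class G c (c v))) = (1 - (real k - 1) * \<alpha>) * real (out_degree G v)"
  proof -
    have mem: "v \<in> color_class G c i \<longleftrightarrow> c v = i" if "v \<in> verts G" for v i
      using that by (simp add: color_class_def)
    have rng: "c v \<in> {1..k}" if "v \<in> verts G" "c ` verts G = {1..k}" for v
      using that by blast
    show thesis
      using fat unfolding fat_coloring_def Let_def
      by (elim conjE exE, intro that) (auto simp: mem rng simp del: atLeastAtMost_iff)
  qed
  have sub: "color_class G c i \<subseteq> verts G" for i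
    by (auto simp: color_class_def)
  have "\<alpha> * real n \<in> \<int>" if n: "n \<in> out_degree G ` verts G" for n
  proof -
    obtain v where v: "v \<in> verts G" "n = out_degree G v" using n by auto
    \<comment> \<open>Since \<open>k \<ge> 2\<close>, at least one of the colors 1 and 2 differs
      from \<open>c v\<close>.\<close>
    obtain i where "i \<in> {1..k}" "c v \<noteq> i"
      using k that[of 1] that[of 2] by (cases "c v = 1") auto
    then show ?thesis
      using other[of v i] v by (metis Ints_of_nat)
  qed
  then have "\<alpha> \<in> \<int>"
    using mult_Gcd_in_Ints[of "out_degree G ` verts G" \<alpha>] gcd by simp
  then obtain m where "\<alpha> = of_int m" by (elim Ints_cases)
  then consider "\<alpha> = 0" | "\<alpha> = 1"
    using \<alpha> by fastforce
  then show ?thesis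
  proof cases
    case 1
    have "c u = c v" if "u \<rightarrow>\<^bsub>G\<^esub> v" for u v
    proof (rule ccontr)
      assume "c u \<noteq> c v"
      moreover have uv: "u \<in> verts G" "v \<in> verts G" using that by auto
      moreover have "c v \<in> {1..k}" using uv img by blast
      \<comment> \<open>With \<alpha> = 0 no vertex has a neighbor in a foreign class, yet
        \<open>v\<close> would be one.\<close>
      ultimately have "nbrs_in G u (color_class G c (c v)) = 0"
        using other[of u "c v"] 1 by simp
      then show False
        using nbrs_in_eq_0_iff[OF sub] that uv by (auto simp: color_class_def)
    qed
    then have const: "\<And>u v. \<lbrakk>u \<in> verts G; v \<in> verts G\<rbrakk> \<Longrightarrow> c u = c v"
      using connected_const[OF conn] by blast
    have "1 \<in> c ` verts G" "2 \<in> c ` verts G" using img k by auto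
    then obtain u v where "u \<in> verts G" "v \<in> verts G" "c u = 1" "c v = 2"
      by (metis imageE)
    then show ?thesis using const[of u v] by simp
  next
    case 2
    \<comment> \<open>If all degrees were 0, their gcd would be 0 rather than 1.\<close>
    obtain v where v: "v \<in> verts G" "out_degree G v \<noteq> 0"
      using gcd Gcd_0_iff[of "out_degree G ` verts G"] by auto
    \<comment> \<open>The right-hand side counts the neighbors of \<open>v\<close> in its own class,
      as \<beta> = 2 - \<open>k\<close> here.\<close>
    have "0 \<le> (2 - real k) * real (out_degree G v)"
      using own[OF v(1)] 2 by (metis add_diff_eq diff_diff_eq2 mult.right_neutral
        of_nat_0_le_iff one_add_one)
    then have k2: "k = 2"
      using v(2) k by (simp add: zero_le_mult_iff)
    have "c u \<noteq> c v" if "u \<rightarrow>\<^bsub>G\<^esub> v" for u v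
    proof
      assume "c u = c v"
      moreover have uv: "u \<in> verts G" "v \<in> verts G" using that by auto
      \<comment> \<open>Now \<beta> = 0, so no vertex has a neighbor of its own color.\<close>
      ultimately have "nbrs_in G u (color_class G c (c v)) = 0"
        using own[of u] 2 k2 by simp
      then show False
        using nbrs_in_eq_0_iff[OF sub] that uv by (auto simp: color_class_def)
    qed
    moreover have "c v = 1 \<or> c v = 2" if "v \<in> verts G" for v
    proof -
      have "c v \<in> {1..2}" using img k2 that by blast
      then show ?thesis by auto
    qed
    ultimately have "bipartite G"
      unfolding bipartite_def
      by (intro exI[of _ "{v \<in> verts G. c v = 1}"] exI[of _ "{v \<in> verts G. c v = 2}"] conjI allI impI)
        (auto, (metis adj_in_verts)+)
    then show ?thesis using k2 by blast
  qed
qed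

end

theorem theorem2p14:
  fixes G :: "('a, 'b) pre_digraph"
  assumes "graph G"
    and "connected G"
    and "Gcd {out_degree G v | v. v \<in> verts G} = 1"
  shows "((fat_chromatic_number G = 1 \<and> \<not> bipartite G) \<or>
          (fat_chromatic_number G = 2 \<and> bipartite G)) \<and>
         \<not> ((fat_chromatic_number G = 1 \<and> \<not> bipartite G) \<and>
            (fat_chromatic_number G = 2 \<and> bipartite G))"
proof -
  interpret graph G by fact
  have gcd: "Gcd (out_degree G ` verts G) = 1"
    using assms(3) by (simp add: setcompr_eq_image)
  obtain v where v: "v \<in> verts G" "out_degree G v \<noteq> 0"
    using gcd Gcd_0_iff[of "out_degree G ` verts G"] by auto
  then obtain w where w: "v \<rightarrow>\<^bsub>G\<^esub> w"
    using nbrs_in_eq_0_iff[of "verts G" v] nbrs_in_verts by auto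
  have ne: "verts G \<noteq> {}" using v by blast
  let ?k = "fat_chromatic_number G"
  obtain c where c: "fat_coloring G ?k c"
    using fat_chromatic_number(1)[OF ne] by blast
  have ge1: "1 \<le> ?k"
    using fat_chromatic_number(2)[OF ne fat_coloring_one[OF ne]] .
  have "?k = 2 \<and> bipartite G" if "2 \<le> ?k"
    using fat_coloring_Gcd_1[OF assms(2) gcd c that] .
  \<comment> \<open>This excludes bipartiteness when \<open>?k = 1\<close>; the preceding fact
    settles every larger value.\<close>
  moreover have "2 \<le> ?k" if "bipartite G"
    using bipartite_fat_coloring[OF that w] fat_chromatic_number(2)[OF ne] by blast
  ultimately show ?thesis
    using ge1 by linarith
qed

end
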